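(* Let $C$ be a projective $[n,k]_2$ three-weight code with non-zero weights $w_1<w_2<w_3$ satisfying $w_1+w_2+w_3=\tfrac{3n}{2}$ and $w_2=\tfrac{n}{2}$. Let $a\geq 0$ be the largest integer such that $C$ is $2^a$-divisible. Then $k\leq 8a+9$.
   Context: An $[n,k]_2$ code is a $k$-dimensional linear subspace $C$ of $\mathbb{F}_2^n$; the weight of a codeword is its number of non-zero entries (Hamming weight). The code is full-length if for no coordinate position all codewords vanish at that position. A binary code is projective if it is full-length and no two distinct coordinate positions $i\neq j$ satisfy $c_i=c_j$ for all $c\in C$. A three-weight code is a linear code having exactly three different non-zero weights. A code is $\Delta$-divisible (for an integer $\Delta\geq1$) if all its weights are divisible by $\Delta$. *)

theory Defs
  imports "HOL-Analysis.Cartesian_Space" "HOL-Library.Z2"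
begin

text \<open>
  Codes are sets of vectors over the two-element field \<^typ>\<open>bit\<close>; the finite index type
  \<open>'n\<close> is the set of coordinate positions, so the length is \<open>CARD('n)\<close>.
\<close>

definition linear_code :: "nat \<Rightarrow> nat \<Rightarrow> (bit ^ 'n) set \<Rightarrow> bool" where
  "linear_code n k C \<longleftrightarrow> CARD('n) = n \<and> vec.subspace C \<and> vec.dim C = k"

definition hamming_weight :: "bit ^ 'n \<Rightarrow> nat" where
  "hamming_weight c = card {i. c $ i \<noteq> 0}"

definition nonzero_weights :: "(bit ^ 'n) set \<Rightarrow> nat set" where
  "nonzero_weights C = hamming_weight ` C - {0}"

definition full_length :: "(bit ^ 'n) set \<Rightarrow> bool" where
  "full_length C \<longleftrightarrow> \<not> (\<exists>i. \<forall>c\<in>C. c $ i = 0)"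

definition projective :: "(bit ^ 'n) set \<Rightarrow> bool" where
  "projective C \<longleftrightarrow> full_length C \<and> \<not> (\<exists>i j. i \<noteq> j \<and> (\<forall>c\<in>C. c $ i = c $ j))"

definition three_weight_code :: "(bit ^ 'n) set \<Rightarrow> bool" where
  "three_weight_code C \<longleftrightarrow> card (nonzero_weights C) = 3"

definition divisible_code :: "nat \<Rightarrow> (bit ^ 'n) set \<Rightarrow> bool" where
  "divisible_code \<Delta> C \<longleftrightarrow> (\<forall>c\<in>C. \<Delta> dvd hamming_weight c)"

end

theory Submission
  imports Defs
begin

text \<open>
  The columns of a projective code, seen as linear functionals on \<open>C\<close>, form a set of \<open>n\<close> distinct
  nonzero points in the dual space, and \<open>f c = n - 2 * hamming_weight c\<close> is the Fourier transform of
  that set.  The weight hypotheses say that \<open>f\<close> takes only the values \<open>s\<close>, \<open>0\<close>, \<open>- s\<close> away from the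
  zero codeword, where \<open>s = w3 - w1\<close>.  The first three power moments of \<open>f\<close> (lemma \<open>moments\<close>), with
  \<open>A1\<close> and \<open>A3\<close> the numbers of codewords of weight \<open>w1\<close> and \<open>w3\<close> and with \<open>m = A3 - A1\<close>, read
  \<open>n = s * m\<close>, \<open>s * (A1 + A3) = m * (2 ^ k - n)\<close>, and \<open>2 ^ k dvd s ^ 3 * (m ^ 3 - m)\<close>.  The last holds
  because \<open>2 ^ k\<close> times the number of ordered triples of columns with sum zero is the third moment.

  Maximality of \<open>a\<close> means \<open>s = 2 ^ (a + 1) * u\<close> with \<open>u\<close> odd, and the second identity gives
  \<open>u dvd m\<close>.  Thus a large \<open>k\<close> puts a large power of two into \<open>m - 1\<close>, \<open>m\<close> or \<open>m + 1\<close>, hence pushes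
  \<open>2 ^ k - n\<close> close to a positive multiple of a large power of two; on the other hand
  \<open>m * (2 ^ k - n) < s * 2 ^ k\<close>, since \<open>A1 + A3 < 2 ^ k\<close>.  Lemma \<open>moment_constraints_force_exception\<close>
  plays these off against each other: for \<open>k \<ge> 8 * a + 10\<close> all requirements are met by a single
  set of parameters, \<open>a = 0\<close>, \<open>k = 10\<close>, \<open>n = 882\<close> with weights 434, 441, 448.  There are 384 codewords
  of weight 441, and these would be all the codewords of odd weight; but the odd-weight codewords,
  if there are any, make up exactly half of the code (lemma \<open>odd_weight_codewords_half\<close>), that is 512.
\<close>

section \<open>The size of a binary code\<close>

lemma card_span_bit:
  fixes B :: "(bit ^ 'n) set"
  assumes "finite B" "vec.independent B"
  shows "finite (vec.span B) \<and> card (vec.span B) = 2 ^ card B"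
  using assms
proof (induction B rule: finite_induct)
  case empty
  then show ?case by simp
next
  case (insert b B)
  have b: "b \<notin> vec.span B" and ind: "vec.independent B"
    using insert.prems insert.hyps(2) by (simp_all add: vec.independent_insert)
  have "vec.span (insert b B) = vec.span B \<union> (\<lambda>x. x + b) ` vec.span B"
  proof (intro equalityI subsetI)
    fix x assume "x \<in> vec.span (insert b B)"
    then obtain t where t: "x - t *s b \<in> vec.span B" by (auto simp: vec.span_insert)
    show "x \<in> vec.span B \<union> (\<lambda>x. x + b) ` vec.span B"
    proof (cases "t = 0")
      case True
      then show ?thesis using t by simp
    next
      case False
      then have "t = 1" by simp
      then have "x - b \<in> vec.span B" using t by simp
      then show ?thesis by (metis UnI2 diff_add_cancel image_eqI)
    qed
  next
    fix x assume "x \<in> vec.span B \<union> (\<lambda>x. x + b) ` vec.span B"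
    then have "x \<in> vec.span B \<or> x - b \<in> vec.span B" by auto
    then have "x - 0 *s b \<in> vec.span B \<or> x - 1 *s b \<in> vec.span B" by simp
    then show "x \<in> vec.span (insert b B)" unfolding vec.span_insert by blast
  qed
  moreover have "vec.span B \<inter> (\<lambda>x. x + b) ` vec.span B = {}"
    using b vec.span_diff by (fastforce dest: vec.span_diff)
  moreover have "card ((\<lambda>x. x + b) ` vec.span B) = card (vec.span B)"
    by (intro card_image inj_onI) simp
  ultimately show ?case
    using insert ind by (simp add: card_Un_disjoint)
qed

lemma card_code:
  fixes C :: "(bit ^ 'n) set"
  assumes "linear_code n k C"
  shows "finite C" "card C = 2 ^ k"
proof -
  have C: "vec.subspace C" "vec.dim C = k" using assms by (auto simp: linear_code_def)
  obtain B where B: "B \<subseteq> C" "vec.independent B" "C \<subseteq> vec.span B" "card B = vec.dim C"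
    using vec.basis_exists[of C] by blast
  have "finite B" using B(2) by (rule vec.finiteI_independent)
  moreover have "vec.span B = C" using B C(1) by (simp add: vec.span_subspace)
  ultimately show "finite C" "card C = 2 ^ k" using card_span_bit[of B] B C by auto
qed

section \<open>Characters and power moments\<close>

text \<open>The nontrivial additive character of the two-element field.\<close>

definition bit_char :: "bit \<Rightarrow> int" where
  "bit_char x = (if x = 0 then 1 else - 1)"

lemma bit_char_simps [simp]: "bit_char 0 = 1" "bit_char 1 = - 1" "bit_char x * bit_char x = 1"
  by (simp_all add: bit_char_def)

lemma bit_char_add: "bit_char (x + y) = bit_char x * bit_char y"
  by (cases x; cases y) simp_all

lemma sum_bit_char_eq_weight:
  fixes c :: "bit ^ 'n"
  shows "(\<Sum>i\<in>UNIV. bit_char (c $ i)) = int CARD('n) - 2 * int (hamming_weight c)"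
proof -
  have "(\<Sum>i\<in>UNIV. bit_char (c $ i)) = (\<Sum>i\<in>(UNIV::'n set). 1 - 2 * (if c $ i \<noteq> 0 then 1 else 0))"
    by (intro sum.cong) (auto simp: bit_char_def)
  also have "\<dots> = int CARD('n) - 2 * int (hamming_weight c)"
    by (simp add: sum_subtractf sum.If_cases hamming_weight_def flip: sum_distrib_left)
  finally show ?thesis .
qed

text \<open>
  Orthogonality: translation by \<open>d\<close> permutes the code and negates the sum.
\<close>

lemma sum_character:
  fixes \<phi> :: "bit ^ 'n \<Rightarrow> int"
  assumes C: "vec.subspace C" and mult: "\<And>c d. \<phi> (c + d) = \<phi> c * \<phi> d"
    and d: "d \<in> C" "\<phi> d = - 1"
  shows "(\<Sum>c\<in>C. \<phi> c) = 0"
proof -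
  have "bij_betw (\<lambda>c. c + d) C C"
    by (rule bij_betw_byWitness[where f' = "\<lambda>c. c - d"])
      (use C d in \<open>auto intro: vec.subspace_add vec.subspace_diff\<close>)
  then have "(\<Sum>c\<in>C. \<phi> (c + d)) = (\<Sum>c\<in>C. \<phi> c)" by (rule sum.reindex_bij_betw)
  then show ?thesis by (simp add: mult d sum_negf)
qed

text \<open>
  Expanding a power of \<open>f\<close> gives sums over the code of products of coordinate characters.  Each such
  product is itself a character, so its sum is \<open>2 ^ k\<close> or \<open>0\<close> according to whether it is trivial.
  Full length makes single coordinates nontrivial, projectivity makes pairs of distinct coordinates
  nontrivial; nothing is known about triples, whence only a divisibility for the third moment.
\<close>

lemma moments:
  fixes C :: "(bit ^ 'n) set"
  assumes lin: "linear_code n k C" and proj: "projective C"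
  defines "f \<equiv> \<lambda>c. int n - 2 * int (hamming_weight c)"
  shows "(\<Sum>c\<in>C. f c) = 0"
    and "(\<Sum>c\<in>C. f c ^ 2) = 2 ^ k * int n"
    and "2 ^ k dvd (\<Sum>c\<in>C. f c ^ 3)"
proof -
  have C: "vec.subspace C" and n: "n = CARD('n)" using lin by (auto simp: linear_code_def)
  note card = card_code(2)[OF lin]
  have f: "f c = (\<Sum>i\<in>UNIV. bit_char (c $ i))" for c :: "bit ^ 'n"
    by (simp add: f_def sum_bit_char_eq_weight n)
  have one: "(\<Sum>c\<in>C. bit_char (c $ i)) = 0" for i
  proof -
    obtain d where "d \<in> C" "d $ i \<noteq> 0"
      using proj unfolding projective_def full_length_def by blast
    then show ?thesis
      by (intro sum_character[OF C, of _ d]) (simp_all only: vector_add_component bit_char_add, simp)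
  qed
  have two: "(\<Sum>c\<in>C. bit_char (c $ i) * bit_char (c $ j)) = (if i = j then 2 ^ k else 0)" for i j
  proof (cases "i = j")
    case True
    then show ?thesis by (simp add: card)
  next
    case False
    then obtain d where "d \<in> C" "d $ i \<noteq> d $ j" using proj unfolding projective_def by blast
    moreover from this have "bit_char (d $ i) * bit_char (d $ j) = - 1"
      by (cases "d $ i"; cases "d $ j") simp_all
    ultimately have "(\<Sum>c\<in>C. bit_char (c $ i) * bit_char (c $ j)) = 0"
      by (intro sum_character[OF C, of _ d]) (simp_all only: vector_add_component bit_char_add ac_simps)
    then show ?thesis using False by simp
  qed
  \<comment> \<open>A product of three characters that never takes the value \<open>- 1\<close> is constantly 1.\<close>
  have three: "2 ^ k dvd (\<Sum>c\<in>C. bit_char (c $ i) * (bit_char (c $ j) * bit_char (c $ l)))" for i j l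
  proof (cases "\<exists>d\<in>C. bit_char (d $ i) * (bit_char (d $ j) * bit_char (d $ l)) = - 1")
    case True
    then obtain d where "d \<in> C" "bit_char (d $ i) * (bit_char (d $ j) * bit_char (d $ l)) = - 1"
      by blast
    then have "(\<Sum>c\<in>C. bit_char (c $ i) * (bit_char (c $ j) * bit_char (c $ l))) = 0"
      by (intro sum_character[OF C, of _ d]) (simp_all only: vector_add_component bit_char_add ac_simps)
    then show ?thesis by simp
  next
    case False
    then have "bit_char (d $ i) * (bit_char (d $ j) * bit_char (d $ l)) = 1" if "d \<in> C" for d
      using that by (fastforce simp: bit_char_def split: if_splits)
    then show ?thesis by (simp add: card)
  qed
  have "(\<Sum>c\<in>C. f c) = (\<Sum>i\<in>UNIV. \<Sum>c\<in>C. bit_char (c $ i))"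
    unfolding f by (rule sum.swap)
  then show "(\<Sum>c\<in>C. f c) = 0" by (simp add: one)
  have "(\<Sum>c\<in>C. f c ^ 2) = (\<Sum>c\<in>C. \<Sum>i\<in>UNIV. \<Sum>j\<in>UNIV. bit_char (c $ i) * bit_char (c $ j))"
    by (simp add: f power2_eq_square sum_product)
  also have "\<dots> = (\<Sum>i\<in>UNIV. \<Sum>c\<in>C. \<Sum>j\<in>UNIV. bit_char (c $ i) * bit_char (c $ j))"
    by (rule sum.swap)
  also have "\<dots> = (\<Sum>i\<in>UNIV. \<Sum>j\<in>UNIV. \<Sum>c\<in>C. bit_char (c $ i) * bit_char (c $ j))"
    by (intro sum.cong refl sum.swap)
  also have "\<dots> = 2 ^ k * int n" by (simp add: two n)
  finally show "(\<Sum>c\<in>C. f c ^ 2) = 2 ^ k * int n" .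
  have "(\<Sum>c\<in>C. f c ^ 3) = (\<Sum>c\<in>C. \<Sum>i\<in>UNIV. \<Sum>j\<in>UNIV. \<Sum>l\<in>UNIV.
      bit_char (c $ i) * (bit_char (c $ j) * bit_char (c $ l)))"
    by (simp add: f power3_eq_cube sum_product sum_distrib_left sum_distrib_right mult_ac)
  also have "\<dots> = (\<Sum>i\<in>UNIV. \<Sum>c\<in>C. \<Sum>j\<in>UNIV. \<Sum>l\<in>UNIV.
      bit_char (c $ i) * (bit_char (c $ j) * bit_char (c $ l)))"
    by (rule sum.swap)
  also have "\<dots> = (\<Sum>i\<in>UNIV. \<Sum>j\<in>UNIV. \<Sum>c\<in>C. \<Sum>l\<in>UNIV.
      bit_char (c $ i) * (bit_char (c $ j) * bit_char (c $ l)))"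
    by (intro sum.cong refl sum.swap)
  also have "\<dots> = (\<Sum>i\<in>UNIV. \<Sum>j\<in>UNIV. \<Sum>l\<in>UNIV. \<Sum>c\<in>C.
      bit_char (c $ i) * (bit_char (c $ j) * bit_char (c $ l)))"
    by (intro sum.cong refl sum.swap)
  finally show "2 ^ k dvd (\<Sum>c\<in>C. f c ^ 3)" by (simp add: three dvd_sum)
qed

lemma parity_multiplicative:
  fixes c d :: "bit ^ 'n"
  shows "(- 1 :: int) ^ hamming_weight (c + d) = (- 1) ^ hamming_weight c * (- 1) ^ hamming_weight d"
proof -
  have "(- 1 :: int) ^ hamming_weight c = (\<Prod>i\<in>UNIV. bit_char (c $ i))" for c :: "bit ^ 'n"
    by (simp add: hamming_weight_def bit_char_def prod.If_cases Collect_neg_eq[symmetric])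
  then show ?thesis by (simp only: vector_add_component bit_char_add prod.distrib)
qed

text \<open>
  Orthogonality for the parity of the weight, which is the product of all coordinate characters.
\<close>

lemma odd_weight_codewords_half:
  fixes C :: "(bit ^ 'n) set"
  assumes lin: "linear_code n k C" and "d \<in> C" "odd (hamming_weight d)"
  shows "2 * card {c \<in> C. odd (hamming_weight c)} = 2 ^ k"
proof -
  have "0 = (\<Sum>c\<in>C. (- 1 :: int) ^ hamming_weight c)"
    using assms by (intro sum_character[symmetric]) (auto simp: linear_code_def parity_multiplicative)
  also have "\<dots> = (\<Sum>c\<in>C. 1 - 2 * (if odd (hamming_weight c) then 1 else 0))"
    by (intro sum.cong) auto
  also have "\<dots> = 2 ^ k - 2 * int (card {c \<in> C. odd (hamming_weight c)})"
    using card_code[OF lin]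
    by (simp add: sum_subtractf sum.If_cases Collect_conj_eq flip: sum_distrib_left)
  finally have "int (2 * card {c \<in> C. odd (hamming_weight c)}) = int (2 ^ k)" by simp
  then show ?thesis by (simp only: of_nat_eq_iff)
qed

text \<open>
  The zero codeword is the only one of weight zero, which explains the lone summand \<open>g 0\<close>.
\<close>

lemma sum_over_weights:
  fixes C :: "(bit ^ 'n) set" and g :: "nat \<Rightarrow> int"
  assumes lin: "linear_code n k C" and w: "nonzero_weights C = {w1, w2, w3}"
    and lt: "w1 < w2" "w2 < w3"
  defines "A \<equiv> \<lambda>w. int (card {c \<in> C. hamming_weight c = w})"
  shows "(\<Sum>c\<in>C. g (hamming_weight c)) = g 0 + A w1 * g w1 + A w2 * g w2 + A w3 * g w3"
proof -
  have fin: "finite C" by (rule card_code(1)[OF lin])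
  have C0: "0 \<in> C" using lin by (simp add: linear_code_def vec.subspace_0)
  have zero: "hamming_weight c = 0 \<longleftrightarrow> c = 0" for c :: "bit ^ 'n"
    by (auto simp: hamming_weight_def vec_eq_iff)
  then have "{c \<in> C. hamming_weight c = 0} = {0}" using C0 by auto
  then have A0: "A 0 = 1" by (simp add: A_def)
  have im: "hamming_weight ` C = {0, w1, w2, w3}"
  proof -
    have "0 \<in> hamming_weight ` C" using C0 zero[of 0] by (metis imageI)
    then have "hamming_weight ` C = insert 0 (nonzero_weights C)"
      unfolding nonzero_weights_def by blast
    then show ?thesis by (simp add: w)
  qed
  have "0 \<notin> {w1, w2, w3}" using w unfolding nonzero_weights_def by (metis Diff_iff singletonI)
  then have dist: "0 \<noteq> w1" "0 \<noteq> w2" "0 \<noteq> w3" "w1 \<noteq> w2" "w1 \<noteq> w3" "w2 \<noteq> w3" using lt by auto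
  have "(\<Sum>c\<in>C. g (hamming_weight c)) =
      (\<Sum>w\<in>hamming_weight ` C. \<Sum>c\<in>{c \<in> C. hamming_weight c = w}. g (hamming_weight c))"
    by (rule sum.image_gen[OF fin])
  also have "\<dots> = (\<Sum>w\<in>hamming_weight ` C. A w * g w)"
    by (intro sum.cong refl) (simp add: A_def)
  also have "\<dots> = A 0 * g 0 + A w1 * g w1 + A w2 * g w2 + A w3 * g w3"
    unfolding im using dist by simp
  finally show ?thesis by (simp add: A0)
qed

section \<open>Arithmetic of the moment identities\<close>

text \<open>
  The hypotheses are the arithmetic shadow of a hypothetical code of dimension \<open>k \<ge> 8 * a + 10\<close>:
  \<open>s\<close> is the distance \<open>w3 - w1\<close> of the extreme weights, the length is \<open>s * m\<close>,
  and \<open>p\<close> is the number of points of the ambient space that are not columns of the code.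
  Divisibility makes \<open>m\<close> extremely close to a multiple of a large power of two; then \<open>p\<close>, too, is
  close to a positive multiple of a large power of two, so both are large, whereas
  \<open>m * p < s * 2 ^ k\<close> bounds their product.  If \<open>m\<close> is even, this is already absurd.  If \<open>m\<close> is odd, the two
  bounds meet so tightly that every free parameter is determined, and \<open>u dvd m\<close> leaves one survivor.
\<close>

lemma moment_constraints_force_exception:
  fixes k a :: nat and u m s p :: int
  assumes u: "odd u" "u > 0" "u dvd m" and m: "m \<ge> 2"
    and s: "s = 2 ^ (a + 1) * u" and p: "p = 2 ^ k - s * m"
    and cubic: "2 ^ k dvd s ^ 3 * (m * (m ^ 2 - 1))"
    and ps: "s < p" and mp: "m * p < s * 2 ^ k"
    and k: "k \<ge> 8 * a + 10"
  shows "a = 0 \<and> k = 10 \<and> u = 7 \<and> m = 63"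
proof -
  define S :: int where "S = 2 ^ a"
  define N where "N = k - (3 * a + 4)"
  define Q :: int where "Q = 2 ^ N"
  have kN: "k = 3 * a + 4 + N" and N: "N \<ge> 5 * a + 6" using k by (auto simp: N_def)
  have S1: "S \<ge> 1" by (simp add: S_def)
  have Spow: "S ^ i = 2 ^ (i * a)" for i by (simp add: S_def power_mult mult.commute)
  \<comment> \<open>All powers of two in sight are now monomials in \<open>S\<close> and \<open>Q\<close>, and the excess dimension is
      the inequality \<open>64 * S ^ 5 \<le> Q\<close>.\<close>
  have q: "(2::int) ^ k = 16 * S ^ 3 * Q"
    by (simp add: kN Q_def Spow power_add)
  have "(2::int) ^ (5 * a + 6) \<le> 2 ^ N" using N by (intro power_increasing) auto
  then have Q: "64 * S ^ 5 \<le> Q" by (simp add: Q_def Spow power_add)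
  have s': "s = 2 * S * u" by (simp add: s S_def)
  have "2 ^ k = (8 * S ^ 3) * (2 * Q)" by (simp add: q)
  moreover have "s ^ 3 * (m * (m ^ 2 - 1)) = (8 * S ^ 3) * (u ^ 3 * (m * (m ^ 2 - 1)))"
    by (simp add: s' power_mult_distrib)
  ultimately have "2 * Q dvd u ^ 3 * (m * (m ^ 2 - 1))"
    using cubic S1 by (metis dvd_mult_cancel_left mult_eq_0_iff power_eq_0_iff zero_neq_numeral not_one_le_zero)
  moreover have "coprime (2 * Q) (u ^ 3)"
    using u(1) by (simp add: Q_def)
  ultimately have two_part: "2 * Q dvd m * (m ^ 2 - 1)"
    by (simp add: coprime_dvd_mult_right_iff)
  have Q0: "Q > 0" by (simp add: Q_def)
  show ?thesis
  proof (cases "even m")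
    case True
    then have "coprime (2 * Q) (m ^ 2 - 1)"
      by (simp add: Q_def)
    then have "2 * Q dvd m" using two_part by (simp add: coprime_dvd_mult_left_iff)
    then obtain h where h: "m = 2 * Q * h" by blast
    have h0: "h > 0" using m h Q0 by (smt (verit) mult_nonneg_nonpos)
    have "coprime u (2 * Q)" using u(1) by (simp add: Q_def)
    then have "u dvd h" using u(3) by (simp add: h coprime_dvd_mult_right_iff)
    then have uh: "u \<le> h" using h0 by (simp add: zdvd_imp_le)
    \<comment> \<open>The bracket is a positive integer, hence at least 1: this is the gap in \<open>p\<close>.\<close>
    have p': "p = 4 * S * Q * (4 * S ^ 2 - u * h)"
      by (simp add: p q s' h algebra_simps power2_eq_square power3_eq_cube)
    have "s > 0" using s' S1 u(2) by simp
    then have "p > 0" using ps by linarith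
    then have "4 * S ^ 2 - u * h > 0"
      unfolding p' by (rule zero_less_mult_pos) (use S1 Q0 in simp)
    then have "4 * S * Q * 1 \<le> p" unfolding p'
      using S1 Q0 by (intro mult_left_mono) auto
    then have "m * (4 * S * Q) \<le> m * p" using m by (intro mult_left_mono) auto
    then have "(8 * S * Q) * (Q * h) < (8 * S * Q) * (4 * S ^ 3 * u)"
      using mp by (simp add: h s' q algebra_simps power2_eq_square power3_eq_cube)
    then have "Q * h < 4 * S ^ 3 * u" by (rule mult_left_less_imp_less) (use S1 Q0 in simp)
    also have "\<dots> \<le> 4 * S ^ 3 * h" using uh S1 by (intro mult_left_mono) auto
    finally have "Q < 4 * S ^ 3" using h0 by simp
    moreover have "S ^ 3 \<le> S ^ 5" using S1 by (intro power_increasing) auto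
    ultimately show ?thesis using Q S1 by (smt (verit) zero_less_power)
  next
    case False
    \<comment> \<open>Only one of \<open>m - 1\<close>, \<open>m + 1\<close> is divisible by 4, so one of them absorbs all factors of two
        of their product except one.\<close>
    obtain \<epsilon> j where \<epsilon>: "\<epsilon> = 1 \<or> \<epsilon> = - 1" and m_near: "m = Q * j - \<epsilon>"
    proof -
      from False obtain l where l: "m = 2 * l + 1" by (elim oddE)
      have "coprime (2 * Q) m" using False by (simp add: Q_def)
      then have "2 * Q dvd m ^ 2 - 1" using two_part by (simp add: coprime_dvd_mult_right_iff)
      also have "m ^ 2 - 1 = 2 * (2 * (l * (l + 1)))" by (simp add: l power2_eq_square algebra_simps)
      finally have d: "Q dvd 2 * (l * (l + 1))" by (simp only: dvd_mult_cancel_left) simp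
      have "N > 0" using N by simp
      then obtain Q' N' where Q': "Q = 2 * Q'" "Q' = 2 ^ N'"
        by (metis Q_def gr0_implies_Suc power_Suc)
      have "Q' dvd l * (l + 1)" using d by (simp add: Q')
      then have "Q' dvd l \<or> Q' dvd l + 1"
      proof (cases "even l")
        case True
        then have "coprime Q' (l + 1)" by (simp add: Q'(2))
        then show ?thesis using \<open>Q' dvd l * (l + 1)\<close> by (simp add: coprime_dvd_mult_left_iff)
      next
        case False
        then have "coprime Q' l" by (simp add: Q'(2))
        then show ?thesis using \<open>Q' dvd l * (l + 1)\<close> by (simp add: coprime_dvd_mult_right_iff)
      qed
      then show ?thesis
      proof
        assume "Q' dvd l"
        then obtain j where "l = Q' * j" by blast
        then show ?thesis using that[of "- 1" j] by (simp add: l Q')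
      next
        assume "Q' dvd l + 1"
        then obtain j where "l + 1 = Q' * j" by blast
        then show ?thesis using that[of 1 j] by (simp add: l Q' algebra_simps)
      qed
    qed
    define D where "D = 8 * S ^ 2 - u * j"
    have j1: "j \<ge> 1"
    proof (rule ccontr)
      assume "\<not> j \<ge> 1"
      then have "Q * j \<le> 0" using Q0 by (simp add: mult_le_0_iff)
      then show False using m_near \<epsilon> m by auto
    qed
    \<comment> \<open>\<open>D\<close> measures how many steps of size \<open>2 * S * Q\<close> lie between \<open>p\<close> and \<open>\<epsilon> * s\<close>; it is positive
        because \<open>p > s\<close>.\<close>
    have p': "p = 2 * S * Q * D + \<epsilon> * s"
      by (simp add: p q s' m_near D_def algebra_simps power2_eq_square power3_eq_cube)
    have s0: "s > 0" using s' S1 u(2) by simp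
    have "\<epsilon> * s \<le> s" using \<epsilon> s0 by auto
    then have "2 * S * Q * D > 0" using ps p' by linarith
    then have "D > 0" by (rule zero_less_mult_pos) (use S1 Q0 in simp)
    then have D1: "D \<ge> 1" by simp
    have uM: "u \<le> u * j" using j1 u(2) by simp
    have S5: "S ^ 5 = S ^ 2 * S ^ 3" by (simp flip: power_add)
    have S2: "S \<le> S ^ 2" "S ^ 2 \<le> S ^ 3" "S ^ 3 \<le> S ^ 5" "S ^ 2 \<le> S ^ 5"
      using S1 by (auto intro: power_increasing self_le_power)
    have "(2 * S) * ((Q * j - \<epsilon>) * (Q * D + \<epsilon> * u)) < (2 * S) * (Q * (16 * S ^ 3 * u))"
      using mp by (simp add: p' m_near s' q algebra_simps power2_eq_square power3_eq_cube)
    then have "(Q * j - \<epsilon>) * (Q * D + \<epsilon> * u) < Q * (16 * S ^ 3 * u)"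
      by (rule mult_left_less_imp_less) (use S1 in simp)
    moreover have "(Q * j - \<epsilon>) * (Q * D + \<epsilon> * u) = Q * (Q * j * D + \<epsilon> * (u * j - D)) - u"
      using \<epsilon> by (auto simp: algebra_simps)
    moreover have "u < Q" using uM D1 Q S2 S1 by (simp add: D_def)
    ultimately have "Q * (Q * j * D + \<epsilon> * (u * j - D)) < Q * (16 * S ^ 3 * u) + Q * 1"
      by linarith
    then have "Q * (Q * j * D + \<epsilon> * (u * j - D)) < Q * (16 * S ^ 3 * u + 1)"
      by (simp only: distrib_left)
    then have "Q * j * D + \<epsilon> * (u * j - D) < 16 * S ^ 3 * u + 1"
      by (rule mult_left_less_imp_less) (use Q0 in simp)
    moreover have "\<epsilon> * (u * j - D) \<ge> - (8 * S ^ 2)"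
    proof -
      have "- (8 * S ^ 2) \<le> u * j - D" "- (8 * S ^ 2) \<le> - (u * j - D)"
        using D1 uM u(2) D_def by linarith+
      then show ?thesis using \<epsilon> by (elim disjE) (simp_all only: mult_1 mult_minus1)
    qed
    ultimately have key: "Q * j * D \<le> 16 * S ^ 3 * u + 8 * S ^ 2" by linarith
    \<comment> \<open>Multiplying by \<open>j\<close> allows replacing \<open>u * j\<close> by \<open>8 * S ^ 2 - D\<close>; the leading terms become
        \<open>64 * S ^ 5 * j ^ 2 * D\<close> against \<open>128 * S ^ 5\<close>, which leaves room only for \<open>j = D = 1\<close>.\<close>
    have "64 * S ^ 5 * (j * D) \<le> Q * (j * D)" using Q j1 D1 by (intro mult_right_mono) auto
    then have "64 * S ^ 5 * (j * D) \<le> 16 * S ^ 3 * u + 8 * S ^ 2" using key by (simp add: mult.assoc)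
    then have "(64 * S ^ 5 * (j * D)) * j \<le> (16 * S ^ 3 * u + 8 * S ^ 2) * j"
      using j1 by (intro mult_right_mono) auto
    also have "\<dots> = 16 * S ^ 3 * (8 * S ^ 2 - D) + 8 * S ^ 2 * j"
      by (simp add: D_def algebra_simps)
    finally have main: "64 * S ^ 5 * (j ^ 2 * D) + 16 * S ^ 3 * D \<le> 128 * S ^ 5 + 8 * S ^ 2 * j"
      by (simp add: S5 algebra_simps power2_eq_square power3_eq_cube)
    have j: "j = 1"
    proof (rule ccontr)
      assume "j \<noteq> 1"
      then have j2: "j \<ge> 2" using j1 by simp
      have "j ^ 2 * 1 \<le> j ^ 2 * D" using D1 by (intro mult_left_mono) auto
      moreover have "2 * j \<le> j ^ 2" using j2 by (simp add: power2_eq_square)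
      ultimately have "64 * S ^ 5 * (2 * j) \<le> 64 * S ^ 5 * (j ^ 2 * D)"
        using S1 by (intro mult_left_mono) auto
      moreover have "8 * S ^ 2 * j \<le> 8 * S ^ 5 * j" using j1 S2 by (intro mult_right_mono) auto
      moreover have "S ^ 5 * 2 \<le> S ^ 5 * j" using j2 S1 by (intro mult_left_mono) auto
      moreover have "16 * S ^ 3 * D > 0" "S ^ 5 > 0" using S1 D1 by auto
      ultimately show False using main by linarith
    qed
    have D: "D = 1"
    proof (rule ccontr)
      assume "D \<noteq> 1"
      then have "D \<ge> 2" using D1 by simp
      then have "64 * S ^ 5 * 2 \<le> 64 * S ^ 5 * D" "16 * S ^ 3 * 2 \<le> 16 * S ^ 3 * D"
        using S1 by (auto intro!: mult_left_mono)
      moreover have "64 * S ^ 5 * D + 16 * S ^ 3 * D \<le> 128 * S ^ 5 + 8 * S ^ 2"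
        using main by (simp add: j)
      ultimately show False using S2 S1 by linarith
    qed
    have u_eq: "u = 8 * S ^ 2 - 1" using D by (simp add: D_def j)
    have "Q \<le> 16 * S ^ 3 * u + 8 * S ^ 2" using key by (simp add: j D)
    also have "\<dots> = 128 * S ^ 5 - 16 * S ^ 3 + 8 * S ^ 2"
      by (simp add: u_eq S5 algebra_simps power2_eq_square power3_eq_cube)
    also have "\<dots> < 128 * S ^ 5" using S2 S1 by linarith
    finally have "(2::int) ^ N < 2 ^ (5 * a + 7)"
      by (simp add: Q_def Spow power_add)
    then have "N < 5 * a + 7" by simp
    then have N_eq: "N = 5 * a + 6" using N by simp
    have Q_eq: "Q = 64 * S ^ 5" by (simp add: Q_def N_eq Spow power_add)
    \<comment> \<open>Division of \<open>m = 64 * S ^ 5 - \<epsilon>\<close> by \<open>u = 8 * S ^ 2 - 1\<close>: the remainder \<open>S - \<epsilon>\<close> is too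
        small to be a nonzero multiple of \<open>u\<close>.\<close>
    have m_eq: "m = (8 * S ^ 3 + S) * u + (S - \<epsilon>)"
      by (simp add: m_near j Q_eq u_eq S5 algebra_simps power2_eq_square power3_eq_cube)
    then have "u dvd S - \<epsilon>" using u(3) by (simp add: dvd_add_right_iff)
    moreover have "\<bar>S - \<epsilon>\<bar> < u" using \<epsilon> S1 S2 by (auto simp: u_eq)
    ultimately have "S = \<epsilon>" using dvd_imp_le_int[of "S - \<epsilon>" u] u(2) by force
    then have "S = 1" "\<epsilon> = 1" using \<epsilon> S1 by auto
    then have "a = 0" using one_less_power[of "2::int" a] by (cases "a = 0") (auto simp: S_def)
    then show ?thesis using kN N_eq u_eq m_eq \<open>S = 1\<close> \<open>\<epsilon> = 1\<close> by simp
  qed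
qed

section \<open>The dimension bound\<close>

theorem lemma5p11:
  fixes C :: "(bit ^ 'n) set" and n k w1 w2 w3 a :: nat
  assumes "linear_code n k C"
    and "projective C"
    and "three_weight_code C"
    and "nonzero_weights C = {w1, w2, w3}"
    and "w1 < w2" and "w2 < w3"
    and "real w1 + real w2 + real w3 = 3 * real n / 2"
    and "real w2 = real n / 2"
    and "divisible_code (2 ^ a) C"
    and "\<And>b. divisible_code (2 ^ b) C \<Longrightarrow> b \<le> a"
  shows "k \<le> 8 * a + 9"
proof (rule ccontr)
  assume "\<not> k \<le> 8 * a + 9"
  then have k: "k \<ge> 8 * a + 10" by simp
  note lin = assms(1)
  have n: "n = 2 * w2" and w13: "w1 + w3 = 2 * w2" using assms(7,8) by linarith+
  define t where "t = int w2 - int w1"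
  define s where "s = 2 * t"
  have t0: "t > 0" using assms(5) by (simp add: t_def)
  have w1: "int w1 = int w2 - t" and w3: "int w3 = int w2 + t" using w13 by (simp_all add: t_def)
  define A where "A w = int (card {c \<in> C. hamming_weight c = w})" for w
  note sums = sum_over_weights[OF lin assms(4-6), folded A_def]
  \<comment> \<open>That all three weights really occur yields the strict inequalities \<open>s < p\<close> (from \<open>w1\<close>) and
      \<open>m * p < s * 2 ^ k\<close> (from \<open>w2\<close>) below.\<close>
  have A_pos: "A w > 0" if "w \<in> {w1, w2, w3}" for w
  proof -
    have "w \<in> nonzero_weights C" using that assms(4) by simp
    then have "{c \<in> C. hamming_weight c = w} \<noteq> {}" unfolding nonzero_weights_def by auto
    then show ?thesis using card_code(1)[OF lin] by (simp add: A_def card_gt_0_iff)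
  qed
  have total: "2 ^ k = 1 + A w1 + A w2 + A w3"
    using sums[of "\<lambda>_. 1"] card_code[OF lin] by simp
  define f where "f w = int n - 2 * int w" for w
  have f: "f 0 = int n" "f w1 = s" "f w2 = 0" "f w3 = - s"
    using n w1 w3 by (simp_all add: f_def s_def)
  note mom = moments[OF lin assms(2), folded f_def]
  have m1: "int n = s * (A w3 - A w1)"
    using sums[of f] mom(1) by (simp add: f algebra_simps)
  have m2: "int n ^ 2 + s ^ 2 * (A w1 + A w3) = 2 ^ k * int n"
    using sums[of "\<lambda>w. f w ^ 2"] mom(2) by (simp add: f algebra_simps)
  have m3: "2 ^ k dvd int n ^ 3 - s ^ 3 * (A w3 - A w1)"
  proof -
    have "int n ^ 3 - s ^ 3 * (A w3 - A w1) = (\<Sum>c\<in>C. f (hamming_weight c) ^ 3)"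
      using sums[of "\<lambda>w. f w ^ 3"] by (simp add: f algebra_simps)
    then show ?thesis using mom(3) by simp
  qed
  define m where "m = A w3 - A w1"
  define p where "p = 2 ^ k - s * m"
  have nm: "int n = s * m" using m1 by (simp add: m_def)
  have s0: "s > 0" using t0 by (simp add: s_def)
  have "s * (s * (A w1 + A w3)) = s * (m * p)"
    using m2 by (simp add: nm p_def algebra_simps power2_eq_square)
  then have mp: "m * p = s * (A w1 + A w3)" using s0 by simp
  have w2m: "int w2 = t * m" using nm n by (simp add: s_def)
  have "w1 > 0"
    using assms(4) unfolding nonzero_weights_def by (metis DiffD2 gr0I insertCI singletonI)
  then have "t * 1 < t * m" using w1 w2m by linarith
  then have m: "m \<ge> 2" using t0 by simp
  \<comment> \<open>The weights are \<open>t * (m - 1)\<close>, \<open>t * m\<close>, \<open>t * (m + 1)\<close>, with greatest common divisor \<open>t\<close>.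
      So \<open>2 ^ a\<close> is the exact power of two in \<open>t\<close>.\<close>
  have t_dvd: "2 ^ a dvd t" and t_ndvd: "\<not> 2 ^ (a + 1) dvd t"
  proof -
    have dvd: "divisible_code (2 ^ b) C \<longleftrightarrow> (\<forall>w\<in>{w1, w2, w3}. 2 ^ b dvd int w)" for b
    proof -
      have "divisible_code (2 ^ b) C \<longleftrightarrow> (\<forall>w\<in>nonzero_weights C. 2 ^ b dvd w)"
        unfolding divisible_code_def nonzero_weights_def by auto
      also have "\<dots> \<longleftrightarrow> (\<forall>w\<in>{w1, w2, w3}. 2 ^ b dvd int w)"
        unfolding assms(4) by (metis of_nat_dvd_iff of_nat_numeral of_nat_power)
      finally show ?thesis .
    qed
    show "2 ^ a dvd t" using assms(9) unfolding dvd t_def by (auto intro: dvd_diff)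
    show "\<not> 2 ^ (a + 1) dvd t"
    proof
      assume d: "2 ^ (a + 1) dvd t"
      then have "2 ^ (a + 1) dvd int w2" unfolding w2m by (rule dvd_mult2)
      then have "divisible_code (2 ^ (a + 1)) C"
        unfolding dvd using d by (auto simp: w1 w3 simp del: power_Suc intro: dvd_diff dvd_add)
      then show False using assms(10)[of "a + 1"] by simp
    qed
  qed
  obtain u where tu: "t = 2 ^ a * u" using t_dvd by blast
  have u: "odd u" using t_ndvd by (auto simp: tu)
  have u0: "u > 0" using t0 by (simp add: tu zero_less_mult_iff)
  have s: "s = 2 ^ (a + 1) * u" by (simp add: s_def tu)
  \<comment> \<open>The second moment identity, with \<open>u\<close> coprime to \<open>2 ^ k\<close>, gives \<open>u dvd m\<close>.\<close>
  have "s dvd m * 2 ^ k"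
  proof -
    have "m * 2 ^ k = s * (A w1 + A w3) + s * m ^ 2"
      using mp by (simp add: p_def algebra_simps power2_eq_square)
    then show ?thesis by simp
  qed
  then have "u dvd m * 2 ^ k" unfolding s by (rule dvd_mult_right)
  then have u_dvd: "u dvd m" using u by (simp add: coprime_dvd_mult_left_iff)
  have cubic: "2 ^ k dvd s ^ 3 * (m * (m ^ 2 - 1))"
    using m3 by (simp add: nm flip: m_def) (simp add: algebra_simps power2_eq_square power3_eq_cube)
  have "s * m < s * (A w1 + A w3)"
    using s0 A_pos[of w1] by (intro mult_strict_left_mono) (auto simp: m_def)
  then have "m * s < m * p" by (simp add: mp mult.commute)
  then have ps: "s < p" using m by simp
  have "s * (A w1 + A w3) < s * 2 ^ k"
    using s0 total A_pos[of w2] by (intro mult_strict_left_mono) auto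
  then have "m * p < s * 2 ^ k" by (simp add: mp)
  from moment_constraints_force_exception[OF u u0 u_dvd m s p_def cubic ps this k]
  have exc: "a = 0" "k = 10" "u = 7" "m = 63" by auto
  \<comment> \<open>The surviving parameters determine the weight distribution, whose odd part is too small.\<close>
  have sval: "s = 14" "t = 7" by (simp_all add: s tu exc)
  have "A w1 + A w3 = 639" using mp by (simp add: p_def exc sval)
  then have A2: "A w2 = 384" using total by (simp add: exc)
  have parity: "even w1" "odd w2" "even w3"
    using w1 w3 w2m by (presburger add: sval exc)+
  have weights: "hamming_weight c \<in> {0, w1, w2, w3}" if "c \<in> C" for c
    using that assms(4) unfolding nonzero_weights_def by blast
  have "{c \<in> C. odd (hamming_weight c)} = {c \<in> C. hamming_weight c = w2}"
    using weights parity by fastforce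
  then have odd_card: "card {c \<in> C. odd (hamming_weight c)} = 384"
    using A2 by (simp add: A_def)
  then obtain d where "d \<in> C" "odd (hamming_weight d)" by (metis (mono_tags, lifting) Collect_empty_eq card.empty zero_neq_numeral)
  then have "2 * card {c \<in> C. odd (hamming_weight c)} = 2 ^ 10"
    using odd_weight_codewords_half[OF lin] by (simp add: exc)
  then show False by (simp add: odd_card)
qed

end
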